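(* Let $n\ge1$ and let $i,j,k$ be nonnegative integers with $\max\{i,j\}\le k\le\min\{i+j,n\}$; set $r:=i+j-k$. Regard $C^k_{i,j}$ as a polynomial in $\beta_1,\dots,\beta_n$. Then \[ \operatorname{Supp}(C^k_{i,j})=Q^k_{i,j}\cap\mathbb{Z}^n, \] where \[ Q^k_{i,j}=\Bigl\{x\in\mathbb{R}^n_{\ge0}:\ \sum_{m=1}^nx_m=r,\ \ \sum_{m=1}^{\ell}x_m\le\ell\ \text{for }1\le\ell\le i,\ \ x_m=0\ \text{for }m>k\Bigr\}. \] Consequently $C^k_{i,j}$ has saturated Newton polytope.
   Context: Let $T\subset \mathrm{GL}_{n+1}$ be the diagonal torus acting on $\mathbb{P}^n$, with $H_T^*(\mathrm{pt})=\mathbb{Z}[t_1,\dots,t_{n+1}]$. For $0\le k\le n$ let $\sigma_k=[X_k]_T\in H_T^*(\mathbb{P}^n)$ be the equivariant class of $X_k=\{x_0=\dots=x_{k-1}=0\}$; with $\zeta=c_1^T(\mathcal{O}(1))$ one has $\sigma_k=\prod_{m=1}^k(\zeta+t_m)$. Structure constants $C^k_{i,j}\in H_T^*(\mathrm{pt})$ are defined by $\sigma_i\sigma_j=\sum_kC^k_{i,j}\sigma_k$. Set $\beta_m=t_m-t_{m+1}$; $C^k_{i,j}$ is a polynomial in the $\beta_m$. $\operatorname{Supp}$ of a polynomial in $\beta_1,\dots,\beta_n$ is the set of exponent vectors in $\mathbb{Z}^n_{\ge0}$ of monomials appearing with nonzero coefficient. A polynomial has saturated Newton polytope (SNP) if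 every lattice point of the convex hull of its support lies in its support. *)

theory Defs
  imports "HOL-Analysis.Finite_Function_Topology" "HOL-Analysis.Convex" "HOL-Computational_Algebra.Polynomial"
begin

text \<open>Integer polynomials in variables indexed by the natural numbers. An exponent vector
  is a finitely supported function from variable indices to exponents.\<close>

type_synonym zpoly = "(nat \<Rightarrow>\<^sub>0 nat) \<Rightarrow>\<^sub>0 int"

definition polys_in :: "nat set \<Rightarrow> zpoly set" where
  "polys_in V = {f. \<forall>a \<in> Poly_Mapping.keys f. Poly_Mapping.keys a \<subseteq> V}"

definition var :: "nat \<Rightarrow> zpoly" where
  "var m = Poly_Mapping.single (Poly_Mapping.single m 1) 1"

definition monom_eval :: "(nat \<Rightarrow> 'a::comm_ring_1) \<Rightarrow> (nat \<Rightarrow>\<^sub>0 nat) \<Rightarrow> 'a" where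
  "monom_eval x a = (\<Prod>m \<in> Poly_Mapping.keys a. x m ^ Poly_Mapping.lookup a m)"

definition zpoly_eval :: "(nat \<Rightarrow> 'a::comm_ring_1) \<Rightarrow> zpoly \<Rightarrow> 'a" where
  "zpoly_eval x P =
     (\<Sum>a \<in> Poly_Mapping.keys P. of_int (Poly_Mapping.lookup P a) * monom_eval x a)"

text \<open>The ring \<open>H\<^sub>T\<^sup>*(P\<^sup>n)\<close> enters through its presentation
  \<open>Z[t\<^sub>1, \<dots>, t\<^sub>n\<^sub>+\<^sub>1][\<zeta>] / (\<Prod>m = 1..n+1. \<zeta> + t\<^sub>m)\<close>. Its elements are represented by univariate polynomials
  in \<open>\<zeta>\<close> whose coefficients are polynomials in \<open>t\<^sub>m = var m\<close>, and \<open>HT_eq n\<close> is equality in the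
  quotient. The class of \<open>X\<^sub>k = {x\<^sub>0 = \<dots> = x\<^sub>k\<^sub>-\<^sub>1 = 0}\<close> is represented by \<open>sigma k\<close>, with \<open>\<zeta> = c\<^sub>1(O(1))\<close>.
  The generator of the ideal is monic in \<open>\<zeta>\<close>, so for representatives with coefficients
  in \<open>Z[t\<^sub>1, \<dots>, t\<^sub>n\<^sub>+\<^sub>1]\<close> it is irrelevant that the cofactor is not restricted to this ring.\<close>

definition sigma :: "nat \<Rightarrow> zpoly poly" where
  "sigma k = (\<Prod>m = 1..k. [:var m, 1:])"

definition HT_eq :: "nat \<Rightarrow> zpoly poly \<Rightarrow> zpoly poly \<Rightarrow> bool" where
  "HT_eq n f g \<longleftrightarrow> (\<Prod>m = 1..n + 1. [:var m, 1:]) dvd f - g"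

definition is_structure_constants :: "nat \<Rightarrow> nat \<Rightarrow> nat \<Rightarrow> (nat \<Rightarrow> zpoly) \<Rightarrow> bool" where
  "is_structure_constants n i j c \<longleftrightarrow>
     (\<forall>k \<le> n. c k \<in> polys_in {1..n + 1}) \<and> (\<forall>k > n. c k = 0) \<and>
     HT_eq n (sigma i * sigma j) (\<Sum>k\<le>n. smult (c k) (sigma k))"

definition structure_constant :: "nat \<Rightarrow> nat \<Rightarrow> nat \<Rightarrow> nat \<Rightarrow> zpoly" where
  "structure_constant n i j = (THE c. is_structure_constants n i j c)"

definition beta :: "nat \<Rightarrow> zpoly" where
  "beta m = var m - var (m + 1)"

text \<open>\<open>in_beta n f\<close> is \<open>f\<close> regarded as a polynomial in \<open>\<beta>\<^sub>1, \<dots>, \<beta>\<^sub>n\<close>: in the result, \<open>var m\<close> stands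
  for \<open>\<beta>\<^sub>m\<close> instead of \<open>t\<^sub>m\<close>.\<close>

definition is_beta_form :: "nat \<Rightarrow> zpoly \<Rightarrow> zpoly \<Rightarrow> bool" where
  "is_beta_form n f P \<longleftrightarrow> P \<in> polys_in {1..n} \<and> zpoly_eval beta P = f"

definition in_beta :: "nat \<Rightarrow> zpoly \<Rightarrow> zpoly" where
  "in_beta n f = (THE P. is_beta_form n f P)"

text \<open>\<open>R\<^sup>n\<close> is the space of finitely supported real functions vanishing outside \<open>{1..n}\<close>, and exponent
  vectors are viewed as points of it.\<close>

definition Rn :: "nat \<Rightarrow> (nat \<Rightarrow>\<^sub>0 real) set" where
  "Rn n = {x. Poly_Mapping.keys x \<subseteq> {1..n}}"

definition Zn :: "nat \<Rightarrow> (nat \<Rightarrow>\<^sub>0 real) set" where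
  "Zn n = {x \<in> Rn n. \<forall>m. Poly_Mapping.lookup x m \<in> \<int>}"

definition Supp :: "zpoly \<Rightarrow> (nat \<Rightarrow>\<^sub>0 real) set" where
  "Supp P = Poly_Mapping.map real ` Poly_Mapping.keys P"

definition SNP :: "nat \<Rightarrow> zpoly \<Rightarrow> bool" where
  "SNP n P \<longleftrightarrow> convex hull (Supp P) \<inter> Zn n \<subseteq> Supp P"

definition Q :: "nat \<Rightarrow> nat \<Rightarrow> nat \<Rightarrow> nat \<Rightarrow> (nat \<Rightarrow>\<^sub>0 real) set" where
  "Q n i j k = {x \<in> Rn n.
     (\<forall>m \<in> {1..n}. 0 \<le> Poly_Mapping.lookup x m) \<and>
     (\<Sum>m = 1..n. Poly_Mapping.lookup x m) = real i + real j - real k \<and>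
     (\<forall>l \<in> {1..i}. (\<Sum>m = 1..l. Poly_Mapping.lookup x m) \<le> real l) \<and>
     (\<forall>m \<in> {1..n}. m > k \<longrightarrow> Poly_Mapping.lookup x m = 0)}"


text \<open>The rest of the theory shows that the two definite descriptions above are proper: for \<open>i, j \<le> n\<close> the
  structure constants exist, are unique, and are polynomials in the \<open>\<beta>\<^sub>m\<close> in a unique way.\<close>

lemma monom_eval_superset:
  assumes "finite S" "Poly_Mapping.keys a \<subseteq> S"
  shows "monom_eval x a = (\<Prod>m \<in> S. x m ^ Poly_Mapping.lookup a m)"
  unfolding monom_eval_def
  by (rule prod.mono_neutral_left) (use assms in \<open>auto simp: in_keys_iff\<close>)

lemma monom_eval_add: "monom_eval x (a + b) = monom_eval x a * monom_eval x b"
proof -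
  let ?S = "Poly_Mapping.keys a \<union> Poly_Mapping.keys b"
  have "Poly_Mapping.keys (a + b) \<subseteq> ?S" by (rule keys_add)
  then show ?thesis
    by (simp add: monom_eval_superset[of ?S] lookup_add power_add prod.distrib)
qed

lemma zpoly_eval_superset:
  assumes "finite S" "Poly_Mapping.keys P \<subseteq> S"
  shows "zpoly_eval x P = (\<Sum>a \<in> S. of_int (Poly_Mapping.lookup P a) * monom_eval x a)"
  unfolding zpoly_eval_def
  by (rule sum.mono_neutral_left) (use assms in \<open>auto simp: in_keys_iff\<close>)

lemma zpoly_eval_0 [simp]: "zpoly_eval x 0 = 0"
  by (simp add: zpoly_eval_def)

lemma zpoly_eval_diff: "zpoly_eval x (P - R) = zpoly_eval x P - zpoly_eval x R"
proof -
  let ?S = "Poly_Mapping.keys P \<union> Poly_Mapping.keys R"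
  have "Poly_Mapping.keys (P - R) \<subseteq> ?S" by (rule keys_diff)
  then show ?thesis
    by (simp add: zpoly_eval_superset[of ?S] lookup_minus sum_subtractf algebra_simps)
qed

lemma zpoly_eval_add: "zpoly_eval x (P + R) = zpoly_eval x P + zpoly_eval x R"
  using zpoly_eval_diff[of x "P + R" R] by simp

lemma zpoly_eval_frag_of [simp]: "zpoly_eval x (frag_of a) = monom_eval x a"
  by (simp add: zpoly_eval_def)

lemma frag_of_mult: "frag_of a * frag_of b = (frag_of (a + b) :: zpoly)"
  by (simp add: mult_single)

lemma zpoly_eval_mult: "zpoly_eval x (P * R) = zpoly_eval x P * zpoly_eval x R"
proof -
  have *: "zpoly_eval x (frag_of a * R) = monom_eval x a * zpoly_eval x R" for a
  proof -
    have "Poly_Mapping.keys R \<subseteq> UNIV" by simp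
    then show ?thesis
      by (induction R rule: frag_induction)
         (simp_all only: frag_of_mult zpoly_eval_frag_of monom_eval_add
           zpoly_eval_diff right_diff_distrib zpoly_eval_0 mult_zero_right)
  qed
  have "Poly_Mapping.keys P \<subseteq> UNIV" by simp
  then show ?thesis
    by (induction P rule: frag_induction)
       (simp_all only: * zpoly_eval_frag_of zpoly_eval_diff left_diff_distrib
          zpoly_eval_0 mult_zero_left)
qed

lemma zpoly_eval_var [simp]: "zpoly_eval x (var m) = x m"
  by (simp add: zpoly_eval_def var_def monom_eval_def)

lemma zpoly_eval_1 [simp]: "zpoly_eval x 1 = 1"
proof -
  have "zpoly_eval x (frag_of 0) = 1"
    by (simp only: zpoly_eval_frag_of) (simp add: monom_eval_def)
  then show ?thesis by simp
qed

lemma zpoly_eval_power: "zpoly_eval x (P ^ e) = zpoly_eval x P ^ e"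
  by (induction e) (simp_all add: zpoly_eval_mult)

lemma zpoly_eval_prod: "zpoly_eval x (\<Prod>m\<in>S. f m) = (\<Prod>m\<in>S. zpoly_eval x (f m))"
  by (induction S rule: infinite_finite_induct) (simp_all add: zpoly_eval_mult)

lemma zpoly_eval_sum: "zpoly_eval x (\<Sum>m\<in>S. f m) = (\<Sum>m\<in>S. zpoly_eval x (f m))"
  by (induction S rule: infinite_finite_induct) (simp_all add: zpoly_eval_add)

lemma monom_eval_var: "monom_eval var a = frag_of a"
proof -
  have pow: "var m ^ e = frag_of (Poly_Mapping.single m e)" for m e
    by (induction e) (simp_all add: var_def mult_single single_add [symmetric])
  have "(\<Prod>m\<in>S. frag_of (f m)) = (frag_of (\<Sum>m\<in>S. f m) :: zpoly)" for S and f :: "nat \<Rightarrow> nat \<Rightarrow>\<^sub>0 nat"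
    by (induction S rule: infinite_finite_induct) (simp_all add: mult_single)
  moreover have "(\<Sum>m\<in>Poly_Mapping.keys a. Poly_Mapping.single m (Poly_Mapping.lookup a m)) = a"
    by (rule poly_mapping_eqI)
       (auto simp: lookup_sum lookup_single when_def in_keys_iff)
  ultimately show ?thesis
    unfolding monom_eval_def pow by simp
qed

lemma zpoly_eval_eq:
  assumes "P \<in> polys_in V" "\<And>m. m \<in> V \<Longrightarrow> x m = y m"
  shows "zpoly_eval x P = zpoly_eval y P"
  unfolding zpoly_eval_def monom_eval_def
  by (intro sum.cong prod.cong arg_cong2[where f = "(*)"] refl)
     (use assms in \<open>auto simp: polys_in_def subset_iff\<close>)

lemma zpoly_eval_id: "zpoly_eval var P = P"
proof -
  have "Poly_Mapping.keys P \<subseteq> UNIV" by simp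
  then show ?thesis
    by (induction P rule: frag_induction)
       (simp_all only: zpoly_eval_0 zpoly_eval_frag_of monom_eval_var zpoly_eval_diff)
qed

lemma zpoly_eval_comp: "zpoly_eval x (zpoly_eval y P) = zpoly_eval (\<lambda>m. zpoly_eval x (y m)) P"
proof -
  have "Poly_Mapping.keys P \<subseteq> UNIV" by simp
  then show ?thesis
    by (induction P rule: frag_induction)
       (simp_all only: zpoly_eval_0 zpoly_eval_frag_of zpoly_eval_diff
          monom_eval_def zpoly_eval_prod zpoly_eval_power)
qed

lemma polys_in_0 [simp]: "0 \<in> polys_in V"
  and polys_in_1 [simp]: "1 \<in> polys_in V"
  and polys_in_var: "m \<in> V \<Longrightarrow> var m \<in> polys_in V"
  by (auto simp: polys_in_def var_def split: if_splits)

lemma polys_in_add: "f \<in> polys_in V \<Longrightarrow> g \<in> polys_in V \<Longrightarrow> f + g \<in> polys_in V"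
  using keys_add[of f g] by (auto simp: polys_in_def)

lemma polys_in_diff: "f \<in> polys_in V \<Longrightarrow> g \<in> polys_in V \<Longrightarrow> f - g \<in> polys_in V"
  using keys_diff[of f g] by (auto simp: polys_in_def)

lemma polys_in_mult:
  assumes "f \<in> polys_in V" "g \<in> polys_in V"
  shows "f * g \<in> polys_in V"
  unfolding polys_in_def
proof (intro CollectI ballI)
  fix c assume "c \<in> Poly_Mapping.keys (f * g)"
  then obtain a b where "c = a + b" "a \<in> Poly_Mapping.keys f" "b \<in> Poly_Mapping.keys g"
    using keys_mult[of f g] by auto
  then show "Poly_Mapping.keys c \<subseteq> V"
    using keys_add[of a b] assms by (auto simp: polys_in_def)
qed

lemma polys_in_sum: "(\<And>m. m \<in> S \<Longrightarrow> f m \<in> polys_in V) \<Longrightarrow> (\<Sum>m\<in>S. f m) \<in> polys_in V"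
  by (induction S rule: infinite_finite_induct) (auto intro: polys_in_add)

lemma polys_in_prod: "(\<And>m. m \<in> S \<Longrightarrow> f m \<in> polys_in V) \<Longrightarrow> (\<Prod>m\<in>S. f m) \<in> polys_in V"
  by (induction S rule: infinite_finite_induct) (auto intro: polys_in_mult)

lemma polys_in_power: "f \<in> polys_in V \<Longrightarrow> f ^ e \<in> polys_in V"
  by (induction e) (auto intro: polys_in_mult)

lemma polys_in_eval:
  assumes "P \<in> polys_in V" "\<And>m. m \<in> V \<Longrightarrow> y m \<in> polys_in W"
  shows "zpoly_eval y P \<in> polys_in W"
proof -
  have "Poly_Mapping.keys P \<subseteq> {a. Poly_Mapping.keys a \<subseteq> V}"
    using assms(1) by (auto simp: polys_in_def)
  then show ?thesis
  proof (induction P rule: frag_induction)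
    case (one a)
    then show ?case using assms(2)
      by (auto simp only: zpoly_eval_frag_of monom_eval_def mem_Collect_eq
          intro!: polys_in_prod polys_in_power)
  qed (simp_all add: zpoly_eval_diff polys_in_diff)
qed


text \<open>Uniqueness of the expression in the \<open>\<beta>\<^sub>m\<close>: substituting
  \<open>\<beta>\<^sub>m + \<dots> + \<beta>\<^sub>n\<close> for \<open>t\<^sub>m\<close> recovers it.\<close>

lemma is_beta_form_unique:
  assumes "is_beta_form n f P" "is_beta_form n f P'"
  shows "P = P'"
proof -
  define y where "y = (\<lambda>m. \<Sum>l = m..n. var l)"
  have "zpoly_eval y f = R" if "is_beta_form n f R" for R
  proof -
    have R: "R \<in> polys_in {1..n}" "f = zpoly_eval beta R"
      using that by (auto simp: is_beta_form_def)
    have "zpoly_eval y (beta m) = var m" if "m \<in> {1..n}" for m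
      using that by (simp add: beta_def zpoly_eval_diff y_def sum.atLeast_Suc_atMost[of m n])
    then have "zpoly_eval y f = zpoly_eval var R"
      unfolding R(2) zpoly_eval_comp by (intro zpoly_eval_eq[OF R(1)]) auto
    then show ?thesis by (simp add: zpoly_eval_id)
  qed
  from this[OF assms(1)] this[OF assms(2)] show ?thesis by simp
qed

lemma in_beta_eq: "is_beta_form n f P \<Longrightarrow> in_beta n f = P"
  unfolding in_beta_def by (rule the_equality) (auto intro: is_beta_form_unique)


lemma degree_sigma [simp]: "degree (sigma k) = k"
  by (simp add: sigma_def degree_prod_eq_sum_degree)

lemma lead_coeff_sigma [simp]: "coeff (sigma k) k = 1"
proof -
  have "lead_coeff (sigma k) = 1"
    unfolding sigma_def lead_coeff_prod by simp
  then show ?thesis by simp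
qed

lemma sigma_Suc: "sigma (Suc k) = [:var (Suc k), 1:] * sigma k"
  by (simp add: sigma_def)

lemma sigma_comb_zero:
  assumes "(\<Sum>k<N. smult (c k) (sigma k)) = 0" "k < N"
  shows "c k = 0"
  using assms
proof (induction N)
  case (Suc N)
  have "coeff (\<Sum>k<N. smult (c k) (sigma k)) N = 0"
    by (auto simp: coeff_sum coeff_eq_0 intro!: sum.neutral)
  then have "c N = coeff (\<Sum>k<Suc N. smult (c k) (sigma k)) N" by simp
  also have "\<dots> = 0" by (simp only: Suc.prems coeff_0)
  finally have N: "c N = 0" .
  with Suc show ?case by (cases "k = N") auto
qed simp

lemma HT_eq_sigma: "HT_eq n f g \<longleftrightarrow> sigma (Suc n) dvd f - g"
  by (simp add: HT_eq_def sigma_def)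

lemma structure_constants_unique:
  assumes "is_structure_constants n i j c" "is_structure_constants n i j d"
  shows "c = d"
proof
  fix k
  let ?S = "\<lambda>c. \<Sum>k\<le>n. smult (c k) (sigma k)"
  have "sigma (Suc n) dvd (sigma i * sigma j - ?S d) - (sigma i * sigma j - ?S c)"
    by (rule dvd_diff) (use assms in \<open>simp_all add: is_structure_constants_def HT_eq_sigma\<close>)
  also have "\<dots> = (\<Sum>k<Suc n. smult (c k - d k) (sigma k))"
    by (simp add: smult_diff_left sum_subtractf lessThan_Suc_atMost)
  finally have dvd: "sigma (Suc n) dvd (\<Sum>k<Suc n. smult (c k - d k) (sigma k))" .
  have "degree (\<Sum>k<Suc n. smult (c k - d k) (sigma k)) \<le> n"
    by (intro degree_sum_le) (auto intro: order.trans[OF degree_smult_le])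
  then have "(\<Sum>k<Suc n. smult (c k - d k) (sigma k)) = 0"
    using dvd dvd_imp_degree_le[OF dvd] by fastforce
  from sigma_comb_zero[OF this, of k] assms show "c k = d k"
    by (cases "k \<le> n") (auto simp: is_structure_constants_def)
qed

text \<open>Existence, together with an expression in the \<open>\<beta>\<^sub>m\<close>, by the expansion
  \<open>(\<zeta> + t\<^sub>m) \<sigma>\<^sub>k = \<sigma>\<^sub>k\<^sub>+\<^sub>1 + (t\<^sub>m - t\<^sub>k\<^sub>+\<^sub>1) \<sigma>\<^sub>k\<close>.\<close>

definition beta_ring :: "nat \<Rightarrow> zpoly set" where
  "beta_ring n = zpoly_eval beta ` polys_in {1..n}"

lemma beta_ring_0: "0 \<in> beta_ring n" and beta_ring_1: "1 \<in> beta_ring n"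
  unfolding beta_ring_def
  by (rule image_eqI[of _ _ 0]; simp) (rule image_eqI[of _ _ 1]; simp)

lemma beta_ring_closed:
  assumes "f \<in> beta_ring n" "g \<in> beta_ring n"
  shows "f + g \<in> beta_ring n" "f - g \<in> beta_ring n" "f * g \<in> beta_ring n"
proof -
  obtain P R where "f = zpoly_eval beta P" "g = zpoly_eval beta R"
    and "P \<in> polys_in {1..n}" "R \<in> polys_in {1..n}"
    using assms by (auto simp: beta_ring_def)
  then show "f + g \<in> beta_ring n" "f - g \<in> beta_ring n" "f * g \<in> beta_ring n"
    unfolding beta_ring_def
    by (auto simp flip: zpoly_eval_add zpoly_eval_diff zpoly_eval_mult
          intro!: imageI polys_in_add polys_in_diff polys_in_mult)
qed

lemma beta_ring_polys_in: "beta_ring n \<subseteq> polys_in {1..n + 1}"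
  unfolding beta_ring_def
  by (auto intro!: polys_in_eval polys_in_diff polys_in_var simp: beta_def)

lemma beta_ring_var_diff:
  assumes "a \<in> {1..n + 1}" "b \<in> {1..n + 1}"
  shows "var a - var b \<in> beta_ring n"
proof -
  have *: "var 1 - var (Suc m) \<in> beta_ring n" if "m \<le> n" for m
    using that
  proof (induction m)
    case (Suc m)
    have "beta (Suc m) \<in> beta_ring n"
      unfolding beta_ring_def using Suc.prems
      by (intro image_eqI[of _ _ "var (Suc m)"]) (auto intro: polys_in_var)
    from beta_ring_closed(1)[OF Suc.IH this] Suc.prems show ?case
      by (simp add: beta_def)
  qed (simp add: beta_ring_0)
  have "var 1 - var a \<in> beta_ring n" "var 1 - var b \<in> beta_ring n"
    using *[of "a - 1"] *[of "b - 1"] assms by auto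
  from beta_ring_closed(2)[OF this(2,1)] show ?thesis by simp
qed

lemma sigma_mult_step: "[:var m, 1:] * sigma k = sigma (Suc k) + smult (var m - var (Suc k)) (sigma k)"
  by (simp add: sigma_Suc smult_diff_left)

lemma structure_constants_exist:
  assumes "i \<le> n" "j \<le> n"
  shows "\<exists>c. is_structure_constants n i j c \<and> (\<forall>k. c k \<in> beta_ring n)"
  using assms(1)
proof (induction i)
  case 0
  let ?c = "\<lambda>k. if k = j then 1 else 0 :: zpoly"
  have "(\<Sum>k\<le>n. smult (?c k) (sigma k)) = (\<Sum>k\<le>n. if k = j then sigma k else 0)"
    by (intro sum.cong) auto
  also have "\<dots> = sigma j" using assms(2) by simp
  finally show ?case using assms(2)
    by (intro exI[of _ ?c])
       (auto simp: is_structure_constants_def HT_eq_def beta_ring_0 beta_ring_1 sigma_def)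
next
  case (Suc i)
  then obtain c where c: "is_structure_constants n i j c" "\<And>k. c k \<in> beta_ring n"
    by (meson Suc_leD)
  define d where "d = (\<lambda>k. if k \<le> n
      then (if k = 0 then 0 else c (k - 1)) + (var (Suc i) - var (Suc k)) * c k else 0)"
  let ?S = "\<lambda>c. \<Sum>k\<le>n. smult (c k) (sigma k)"
  let ?b = "var (Suc i)"
  have d: "d k \<in> beta_ring n" for k
    using Suc.prems c(2) unfolding d_def
    by (auto intro!: beta_ring_closed(1,3) beta_ring_0 beta_ring_var_diff)
  have "[:?b, 1:] * ?S c = (\<Sum>k\<le>n. smult (c k) ([:?b, 1:] * sigma k))"
    by (simp add: sum_distrib_left)
  also have "\<dots> = (\<Sum>k\<le>n. smult (c k) (sigma (Suc k))) +
      (\<Sum>k\<le>n. smult ((?b - var (Suc k)) * c k) (sigma k))"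
    unfolding sigma_mult_step by (simp add: smult_add_right sum.distrib mult.commute)
  also have "(\<Sum>k\<le>n. smult (c k) (sigma (Suc k))) =
      (\<Sum>k\<le>Suc n. smult (if k = 0 then 0 else c (k - 1)) (sigma k))"
    by (subst sum.atMost_Suc_shift) simp
  also have "\<dots> = (\<Sum>k\<le>n. smult (if k = 0 then 0 else c (k - 1)) (sigma k)) +
      smult (c n) (sigma (Suc n))"
    by simp
  finally have "[:?b, 1:] * ?S c = ?S d + smult (c n) (sigma (Suc n))"
    by (simp add: d_def smult_add_left sum.distrib)
  then have "sigma (Suc i) * sigma j - ?S d =
      [:?b, 1:] * (sigma i * sigma j - ?S c) + smult (c n) (sigma (Suc n))"
    unfolding sigma_Suc[of i] right_diff_distrib by (simp only: mult.assoc) simp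
  moreover have "sigma (Suc n) dvd \<dots>"
    using c(1) by (intro dvd_add dvd_mult dvd_smult dvd_refl)
      (simp add: is_structure_constants_def HT_eq_sigma)
  ultimately have "HT_eq n (sigma (Suc i) * sigma j) (?S d)"
    by (simp add: HT_eq_sigma)
  moreover have "\<forall>k \<le> n. d k \<in> polys_in {1..n + 1}"
    using d beta_ring_polys_in by blast
  moreover have "\<forall>k > n. d k = 0"
    by (simp add: d_def)
  ultimately have "is_structure_constants n (Suc i) j d"
    by (simp only: is_structure_constants_def simp_thms)
  then show ?case using d by blast
qed

lemma is_structure_constants_structure_constant:
  assumes "i \<le> n" "j \<le> n"
  shows "is_structure_constants n i j (structure_constant n i j)"
    and "is_beta_form n (structure_constant n i j k) (in_beta n (structure_constant n i j k))"
proof -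
  obtain c where c: "is_structure_constants n i j c" "\<And>k. c k \<in> beta_ring n"
    using structure_constants_exist[OF assms] by blast
  then have eq: "structure_constant n i j = c"
    unfolding structure_constant_def
    by (intro the_equality) (auto intro: structure_constants_unique)
  with c show "is_structure_constants n i j (structure_constant n i j)" by simp
  from c(2)[of k] obtain P where P: "is_beta_form n (c k) P"
    by (auto simp: beta_ring_def is_beta_form_def)
  then show "is_beta_form n (structure_constant n i j k) (in_beta n (structure_constant n i j k))"
    by (simp add: eq in_beta_eq[OF P])
qed

end

theory Submission
  imports Defs
begin

text \<open>In \<open>Z[t][\<zeta>]\<close> one has \<open>(\<zeta> + t\<^sub>i\<^sub>+\<^sub>1) \<sigma>\<^sub>k = \<sigma>\<^sub>k\<^sub>+\<^sub>1 + (\<beta>\<^sub>i\<^sub>+\<^sub>1 + \<dots> + \<beta>\<^sub>k) \<sigma>\<^sub>k\<close> for \<open>k \<ge> i\<close>. Multiplying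
  by one linear factor at a time therefore gives a recursion for the structure constants in which all
  coefficients are nonnegative. Nothing cancels, so the supports obey the set-theoretic version of the
  recursion, and the lattice points of \<open>Q\<close> satisfy it too: a point with a positive coordinate \<open>x\<^sub>m\<close>,
  \<open>m > i\<close>, comes from lowering this coordinate, and any other point is already a point for \<open>(i, j, k - 1)\<close>.\<close>

section \<open>Recursion for the structure constants in the variables \<open>beta m\<close>\<close>

fun beta_const :: "nat \<Rightarrow> nat \<Rightarrow> nat \<Rightarrow> zpoly" where
  "beta_const 0 j k = (if k = j then 1 else 0)"
| "beta_const (Suc i) j k = (if k \<le> i then 0
     else beta_const i j (k - 1) + (\<Sum>m = Suc i..k. var m) * beta_const i j k)"

text \<open>Lets summation ranges be enlarged and indices be shifted without new terms.\<close>

lemma beta_const_eq_0: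
  assumes "k < i \<or> k < j \<or> i + j < k"
  shows "beta_const i j k = 0"
  using assms
proof (induction i arbitrary: k)
  case (Suc i)
  then show ?case
    using Suc.IH[of "k - 1"] Suc.IH[of k] by fastforce
qed auto

lemma beta_const_polys_in: "beta_const i j k \<in> polys_in {1..k}"
proof (induction i arbitrary: k)
  case (Suc i)
  have "beta_const i j (k - 1) \<in> polys_in {1..k}"
    using Suc.IH[of "k - 1"] unfolding polys_in_def by fastforce
  moreover have "(\<Sum>m = Suc i..k. var m) \<in> polys_in {1..k}"
    by (intro polys_in_sum polys_in_var) auto
  ultimately show ?case
    using Suc.IH[of k] by (auto intro: polys_in_add polys_in_mult)
qed simp

text \<open>The \<open>beta m\<close> telescope; for \<open>k = i\<close> the empty sum matches a
  vanishing difference.\<close>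

lemma zpoly_eval_beta_sum:
  assumes "i \<le> k"
  shows "zpoly_eval beta (\<Sum>m = Suc i..k. var m) = var (Suc i) - var (Suc k)"
  using assms
  by (induction k rule: dec_induct) (simp_all add: zpoly_eval_add beta_def)

text \<open>This holds in the polynomial ring itself, before passing to the quotient, so
  \<open>n\<close> does not enter. The factors of \<open>sigma i\<close> are multiplied in one at a
  time by \<open>sigma_mult_step\<close>.\<close>

lemma sigma_mult_expansion:
  "sigma i * sigma j = (\<Sum>k\<le>i + j. smult (zpoly_eval beta (beta_const i j k)) (sigma k))"
proof (induction i)
  case 0
  have "(\<Sum>k\<le>j. smult (zpoly_eval beta (beta_const 0 j k)) (sigma k)) =
      (\<Sum>k\<le>j. if k = j then sigma k else 0)"
    by (intro sum.cong) auto
  then show ?case by (simp add: sigma_def)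
next
  case (Suc i)
  let ?c = "\<lambda>i k. zpoly_eval beta (beta_const i j k)"
  let ?N = "i + j"
  have step: "?c (Suc i) k = (if k = 0 then 0 else ?c i (k - 1)) + (var (Suc i) - var (Suc k)) * ?c i k" for k
  proof (cases "k \<le> i")
    \<comment> \<open>The guard in the recursion loses nothing: \<open>?c i (k - 1)\<close> vanishes
      as \<open>k - 1 < i\<close>, and in the second term \<open>?c i k\<close> vanishes for
      \<open>k < i\<close>, the difference of variables for \<open>k = i\<close>. For
      \<open>k = 0\<close> it also avoids truncation in \<open>k - 1\<close>.\<close>
    case True
    then show ?thesis
      by (cases "k = i"; cases k) (auto simp: beta_const_eq_0)
  next
    case False
    then show ?thesis
      by (simp add: zpoly_eval_add zpoly_eval_mult zpoly_eval_beta_sum del: sum.cl_ivl_Suc)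
  qed
  have "sigma (Suc i) * sigma j = [:var (Suc i), 1:] * (\<Sum>k\<le>?N. smult (?c i k) (sigma k))"
    by (simp only: sigma_Suc mult.assoc Suc.IH)
  also have "\<dots> = (\<Sum>k\<le>?N. smult (?c i k) ([:var (Suc i), 1:] * sigma k))"
    by (simp add: sum_distrib_left)
  also have "\<dots> = (\<Sum>k\<le>?N. smult (?c i k) (sigma (Suc k))) +
      (\<Sum>k\<le>?N. smult ((var (Suc i) - var (Suc k)) * ?c i k) (sigma k))"
    unfolding sigma_mult_step by (simp add: smult_add_right sum.distrib mult.commute)
  also have "(\<Sum>k\<le>?N. smult (?c i k) (sigma (Suc k))) =
      (\<Sum>k\<le>Suc ?N. smult (if k = 0 then 0 else ?c i (k - 1)) (sigma k))"
    by (subst sum.atMost_Suc_shift) simp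
  \<comment> \<open>The added top term lies beyond \<open>i + j\<close>, where the constants are
    zero.\<close>
  also have "(\<Sum>k\<le>?N. smult ((var (Suc i) - var (Suc k)) * ?c i k) (sigma k)) =
      (\<Sum>k\<le>Suc ?N. smult ((var (Suc i) - var (Suc k)) * ?c i k) (sigma k))"
    by (simp add: beta_const_eq_0)
  finally show ?case
    unfolding step smult_add_left sum.distrib by simp
qed

section \<open>Passage to the quotient ring and to the definite descriptions\<close>

lemma is_structure_constants_beta_const:
  "is_structure_constants n i j (\<lambda>k. if k \<le> n then zpoly_eval beta (beta_const i j k) else 0)"
proof -
  let ?c = "\<lambda>k. zpoly_eval beta (beta_const i j k)"
  \<comment> \<open>\<open>n\<close> may lie on either side of \<open>i + j\<close>; a common upper
    bound lets the sum be split at \<open>n\<close>.\<close>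
  let ?N = "max n (i + j)"
  have "?c k \<in> polys_in {1..n + 1}" if "k \<le> n" for k
    using beta_const_polys_in[of i j k] that
    by (rule_tac polys_in_eval) (auto simp: beta_def intro!: polys_in_diff polys_in_var)
  moreover have "HT_eq n (sigma i * sigma j) (\<Sum>k\<le>n. smult (if k \<le> n then ?c k else 0) (sigma k))"
  proof -
    have "sigma i * sigma j = (\<Sum>k\<le>?N. smult (?c k) (sigma k))"
      unfolding sigma_mult_expansion
      by (rule sum.mono_neutral_left) (auto simp: beta_const_eq_0)
    also have "\<dots> = (\<Sum>k\<in>{..n} \<union> {n<..?N}. smult (?c k) (sigma k))"
      by (rule sum.cong) auto
    also have "\<dots> = (\<Sum>k\<le>n. smult (?c k) (sigma k)) + (\<Sum>k\<in>{n<..?N}. smult (?c k) (sigma k))"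
      by (rule sum.union_disjoint) auto
    finally have "sigma i * sigma j - (\<Sum>k\<le>n. smult (if k \<le> n then ?c k else 0) (sigma k)) =
        (\<Sum>k\<in>{n<..?N}. smult (?c k) (sigma k))"
      by simp
    \<comment> \<open>The classes beyond \<open>n\<close> contain every factor of the relation, so
      they die in the quotient.\<close>
    moreover have "sigma (Suc n) dvd sigma k" if "n < k" for k
      unfolding sigma_def using that by (intro prod_dvd_prod_subset) auto
    ultimately show ?thesis
      unfolding HT_eq_sigma by (auto intro!: dvd_sum dvd_smult)
  qed
  ultimately show ?thesis
    by (simp add: is_structure_constants_def)
qed

text \<open>Both definite descriptions are unique, so witnesses suffice; \<open>k \<le> n\<close>
  keeps the variables \<open>1..k\<close> among the allowed \<open>1..n\<close>.\<close>

lemma in_beta_structure_constant: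
  assumes "k \<le> n"
  shows "in_beta n (structure_constant n i j k) = beta_const i j k"
proof -
  have "structure_constant n i j = (\<lambda>k. if k \<le> n then zpoly_eval beta (beta_const i j k) else 0)"
    unfolding structure_constant_def
    by (rule the_equality)
       (auto intro: structure_constants_unique is_structure_constants_beta_const)
  moreover have "beta_const i j k \<in> polys_in {1..n}"
    using beta_const_polys_in[of i j k] assms unfolding polys_in_def by fastforce
  ultimately show ?thesis
    using assms by (intro in_beta_eq) (simp add: is_beta_form_def)
qed

section \<open>Supports of sums and products without cancellation\<close>

definition nonneg_coeffs :: "zpoly \<Rightarrow> bool" where
  "nonneg_coeffs f \<longleftrightarrow> (\<forall>a. 0 \<le> Poly_Mapping.lookup f a)"

text \<open>Two nonnegative integers add up to zero only if both are zero, so no monomial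
  cancels.\<close>

lemma nonneg_coeffs_add:
  assumes "nonneg_coeffs f" "nonneg_coeffs g"
  shows "nonneg_coeffs (f + g)"
    and "Poly_Mapping.keys (f + g) = Poly_Mapping.keys f \<union> Poly_Mapping.keys g"
  using assms by (auto simp: nonneg_coeffs_def lookup_add in_keys_iff add_nonneg_eq_0_iff)

lemma nonneg_coeffs_sum:
  assumes "finite S" "\<And>m. m \<in> S \<Longrightarrow> nonneg_coeffs (f m)"
  shows "nonneg_coeffs (\<Sum>m\<in>S. f m)"
    and "Poly_Mapping.keys (\<Sum>m\<in>S. f m) = (\<Union>m\<in>S. Poly_Mapping.keys (f m))"
proof -
  have "nonneg_coeffs (\<Sum>m\<in>S. f m) \<and>
      Poly_Mapping.keys (\<Sum>m\<in>S. f m) = (\<Union>m\<in>S. Poly_Mapping.keys (f m))"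
    using assms
    by (induction S rule: finite_induct) (simp add: nonneg_coeffs_def, simp add: nonneg_coeffs_add)
  then show "nonneg_coeffs (\<Sum>m\<in>S. f m)"
    and "Poly_Mapping.keys (\<Sum>m\<in>S. f m) = (\<Union>m\<in>S. Poly_Mapping.keys (f m))"
    by auto
qed

lemma lookup_var_mult:
  "Poly_Mapping.lookup (var m * f) (Poly_Mapping.single m 1 + a) = Poly_Mapping.lookup f a"
  and lookup_var_mult_eq_0:
  "(\<And>a. c \<noteq> Poly_Mapping.single m 1 + a) \<Longrightarrow> Poly_Mapping.lookup (var m * f) c = 0"
proof -
  \<comment> \<open>Both claims pass to differences in \<open>f\<close>, so it suffices to check
    monomials, where exponents are cancelled.\<close>
  have 1: "Poly_Mapping.lookup (var m * f) (Poly_Mapping.single m 1 + a) = Poly_Mapping.lookup f a \<and>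
    ((\<forall>a. c \<noteq> Poly_Mapping.single m 1 + a) \<longrightarrow> Poly_Mapping.lookup (var m * f) c = 0)" for a c
  proof -
    have "Poly_Mapping.keys f \<subseteq> UNIV" by simp
    then show ?thesis
    proof (induction f rule: frag_induction)
      case (one b)
      then show ?case
        by (auto simp: var_def mult_single lookup_single when_def)
    qed (auto simp: right_diff_distrib lookup_minus)
  qed
  then show "Poly_Mapping.lookup (var m * f) (Poly_Mapping.single m 1 + a) = Poly_Mapping.lookup f a"
    and "(\<And>a. c \<noteq> Poly_Mapping.single m 1 + a) \<Longrightarrow> Poly_Mapping.lookup (var m * f) c = 0"
    by auto
qed

lemma keys_var_mult:
  "Poly_Mapping.keys (var m * f) = (+) (Poly_Mapping.single m 1) ` Poly_Mapping.keys f"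
proof (rule set_eqI)
  fix c
  show "c \<in> Poly_Mapping.keys (var m * f) \<longleftrightarrow>
      c \<in> (+) (Poly_Mapping.single m 1) ` Poly_Mapping.keys f"
    using lookup_var_mult[of m f] lookup_var_mult_eq_0[of c m f]
    by (cases "\<exists>a. c = Poly_Mapping.single m 1 + a") (auto simp: in_keys_iff)
qed

lemma nonneg_coeffs_var_mult:
  assumes "nonneg_coeffs f"
  shows "nonneg_coeffs (var m * f)"
  unfolding nonneg_coeffs_def
proof
  fix c
  show "0 \<le> Poly_Mapping.lookup (var m * f) c"
    using lookup_var_mult[of m f] lookup_var_mult_eq_0[of c m f] assms
    by (cases "\<exists>a. c = Poly_Mapping.single m 1 + a") (auto simp: nonneg_coeffs_def)
qed

section \<open>Lattice points and their recursion\<close>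

text \<open>The conditions of \<open>Q\<close> for natural exponents, with \<open>k\<close> in place
  of \<open>n\<close>. The degree condition is additive because natural subtraction truncates;
  \<open>i \<le> k\<close> and \<open>j \<le> k\<close> empty the set at small \<open>k\<close>,
  which the recursion also visits.\<close>

definition lattice_pts :: "nat \<Rightarrow> nat \<Rightarrow> nat \<Rightarrow> (nat \<Rightarrow>\<^sub>0 nat) set" where
  "lattice_pts i j k = {a. i \<le> k \<and> j \<le> k \<and> Poly_Mapping.keys a \<subseteq> {1..k} \<and>
     k + (\<Sum>m = 1..k. Poly_Mapping.lookup a m) = i + j \<and>
     (\<forall>l \<le> i. (\<Sum>m = 1..l. Poly_Mapping.lookup a m) \<le> l)}"

lemma sum_lookup_single_add:
  "(\<Sum>m = 1..l. Poly_Mapping.lookup (Poly_Mapping.single p 1 + a) m) =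
     (if p \<in> {1..l} then 1 else 0) + (\<Sum>m = 1..l. Poly_Mapping.lookup a m)"
  for a :: "nat \<Rightarrow>\<^sub>0 nat"
  by (simp add: lookup_add sum.distrib lookup_single when_def)

lemma keys_single_add:
  "Poly_Mapping.keys (Poly_Mapping.single p 1 + a) = insert p (Poly_Mapping.keys (a :: nat \<Rightarrow>\<^sub>0 nat))"
  by (auto simp: in_keys_iff lookup_add lookup_single when_def split: if_splits)

text \<open>A unit in a coordinate beyond \<open>i\<close> does not affect prefix sums up to
  \<open>i\<close>. The one new prefix condition, at \<open>Suc i\<close>, is automatic on the
  right-hand side: the total there is \<open>Suc i + j - k\<close>, at most \<open>Suc i\<close>
  because \<open>j \<le> k\<close>.\<close>

lemma lattice_pts_Suc:
  assumes "i < k"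
  shows "lattice_pts (Suc i) j k = lattice_pts i j (k - 1) \<union>
    (\<Union>m\<in>{Suc i..k}. (+) (Poly_Mapping.single m 1) ` lattice_pts i j k)"
    (is "?L = ?A \<union> ?B")
proof (intro equalityI subsetI)
  fix a assume a: "a \<in> ?L"
  let ?s = "\<lambda>(a :: nat \<Rightarrow>\<^sub>0 nat) l. \<Sum>m = 1..l. Poly_Mapping.lookup a m"
  have L: "j \<le> k" "Poly_Mapping.keys a \<subseteq> {1..k}" "k + ?s a k = Suc i + j"
    "\<And>l. l \<le> Suc i \<Longrightarrow> ?s a l \<le> l"
    using a by (auto simp: lattice_pts_def)
  show "a \<in> ?A \<union> ?B"
  proof (cases "\<exists>p\<in>{Suc i..k}. p \<in> Poly_Mapping.keys a")
    case True
    then obtain p where p: "p \<in> {Suc i..k}" "p \<in> Poly_Mapping.keys a" by blast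
    \<comment> \<open>The subtraction is exact because \<open>p\<close> occurs in
      \<open>a\<close>.\<close>
    define b where "b = a - Poly_Mapping.single p 1"
    have ab: "a = Poly_Mapping.single p 1 + b"
      using p(2) by (intro poly_mapping_eqI)
        (auto simp: b_def lookup_add lookup_minus lookup_single when_def in_keys_iff)
    have "Poly_Mapping.keys b \<subseteq> {1..k}"
      using L(2) unfolding ab keys_single_add by simp
    moreover have "?s a k = Suc (?s b k)"
      using p(1) unfolding ab sum_lookup_single_add by simp
    moreover have "?s b l \<le> l" if "l \<le> i" for l
      using L(4)[of l] p(1) that unfolding ab sum_lookup_single_add by simp
    ultimately have "b \<in> lattice_pts i j k"
      using L(1,3) assms by (simp add: lattice_pts_def)
    then show ?thesis using p(1) ab by blast
  next
    case False
    then have keys: "Poly_Mapping.keys a \<subseteq> {1..i}"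
      using L(2) by (force simp: not_less_eq_eq)
    have "?s a l = ?s a i" if "i \<le> l" for l
      using keys that by (intro sum.mono_neutral_right) (auto simp: in_keys_iff subset_iff)
    from this[of k] this[of "k - 1"] have "?s a k = ?s a i" "?s a (k - 1) = ?s a i"
      using assms by auto
    moreover have "?s a l \<le> l" if "l \<le> i" for l
      using L(4)[of l] that by simp
    moreover have "{1..i} \<subseteq> {1..k - 1}"
      using assms by auto
    then have "Poly_Mapping.keys a \<subseteq> {1..k - 1}"
      using keys by (rule order.trans[rotated])
    \<comment> \<open>The total \<open>Suc i + j - k\<close> now sits in the first \<open>i\<close>
      coordinates, so it is at most \<open>i\<close>, which forces \<open>j < k\<close>.\<close>
    moreover have "j \<le> k - 1"
      using L(4)[of i] L(1,3) \<open>?s a k = ?s a i\<close> assms by linarith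
    ultimately have "a \<in> ?A"
      using L(1,3) assms by (simp add: lattice_pts_def)
    then show ?thesis by blast
  qed
next
  fix a assume "a \<in> ?A \<union> ?B"
  let ?s = "\<lambda>(a :: nat \<Rightarrow>\<^sub>0 nat) l. \<Sum>m = 1..l. Poly_Mapping.lookup a m"
  have mono: "?s b l \<le> ?s b l'" if "l \<le> l'" for b and l l' :: nat
    using that by (intro sum_mono2) auto
  from \<open>a \<in> ?A \<union> ?B\<close> show "a \<in> ?L"
  proof
    assume "a \<in> ?A"
    then have A: "j \<le> k - 1" "Poly_Mapping.keys a \<subseteq> {1..k - 1}" "k - 1 + ?s a (k - 1) = i + j"
      "\<And>l. l \<le> i \<Longrightarrow> ?s a l \<le> l"
      by (auto simp: lattice_pts_def)
    have sk: "?s a k = ?s a (k - 1)"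
      using A(2) by (intro sum.mono_neutral_right) (auto simp: in_keys_iff subset_iff)
    have "?s a (Suc i) \<le> Suc i"
      using mono[of "Suc i" k a] sk A(1,3) assms by linarith
    then have "?s a l \<le> l" if "l \<le> Suc i" for l
      using A(4)[of l] that by (cases "l = Suc i") auto
    moreover have "Poly_Mapping.keys a \<subseteq> {1..k}"
      using A(2) by (rule order.trans) auto
    moreover have "k + ?s a k = Suc i + j"
      using sk A(3) assms by linarith
    moreover have "Suc i \<le> k" "j \<le> k"
      using A(1) assms by linarith+
    ultimately show ?thesis
      unfolding lattice_pts_def by blast
  next
    assume "a \<in> ?B"
    then obtain p b where p: "p \<in> {Suc i..k}" and b: "b \<in> lattice_pts i j k"
      and ab: "a = Poly_Mapping.single p 1 + b" by blast
    have B: "j \<le> k" "Poly_Mapping.keys b \<subseteq> {1..k}" "k + ?s b k = i + j"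
      "\<And>l. l \<le> i \<Longrightarrow> ?s b l \<le> l"
      using b by (auto simp: lattice_pts_def)
    have sk: "?s a k = Suc (?s b k)"
      using p unfolding ab sum_lookup_single_add by simp
    have "?s a l \<le> l" if "l \<le> i" for l
      using B(4)[of l] p that unfolding ab sum_lookup_single_add by simp
    moreover have "?s a (Suc i) \<le> Suc i"
      using mono[of "Suc i" k a] sk B(1,3) assms by linarith
    ultimately have "?s a l \<le> l" if "l \<le> Suc i" for l
      using that by (cases "l = Suc i") auto
    moreover have "Poly_Mapping.keys a \<subseteq> {1..k}"
      using p B(2) unfolding ab keys_single_add by simp
    moreover have "k + ?s a k = Suc i + j"
      using sk B(3) by linarith
    moreover have "Suc i \<le> k"
      using assms by linarith
    ultimately show ?thesis
      using B(1) unfolding lattice_pts_def by blast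
  qed
qed

text \<open>One induction carries both claims: nonnegativity turns the sums of the recursion into
  unions of supports, and \<open>lattice_pts_Suc\<close> recombines these.\<close>

lemma keys_beta_const: "Poly_Mapping.keys (beta_const i j k) = lattice_pts i j k"
  and nonneg_coeffs_beta_const: "nonneg_coeffs (beta_const i j k)"
proof -
  have "nonneg_coeffs (beta_const i j k) \<and> Poly_Mapping.keys (beta_const i j k) = lattice_pts i j k"
  proof (induction i arbitrary: k)
    case 0
    have "lattice_pts 0 j k = (if k = j then {0} else {})"
    proof -
      have "k = j \<and> a = 0" if "a \<in> lattice_pts 0 j k" for a
      proof -
        have a: "j \<le> k" "Poly_Mapping.keys a \<subseteq> {1..k}" "k + (\<Sum>m = 1..k. Poly_Mapping.lookup a m) = j"
          using that by (simp_all add: lattice_pts_def)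
        \<comment> \<open>With \<open>j \<le> k\<close> the degree equation leaves no room for a
          positive exponent.\<close>
        then have "k = j" "(\<Sum>m = 1..k. Poly_Mapping.lookup a m) = 0"
          by linarith+
        then have "m \<notin> Poly_Mapping.keys a" for m
          using a(2) by (auto simp: in_keys_iff)
        then have "a = 0"
          using keys_eq_empty by blast
        then show ?thesis using \<open>k = j\<close> by simp
      qed
      moreover have "0 \<in> lattice_pts 0 j j"
        by (simp add: lattice_pts_def)
      ultimately show ?thesis by auto
    qed
    then show ?case
      by (auto simp: nonneg_coeffs_def lookup_one when_def)
  next
    case (Suc i)
    show ?case
    proof (cases "k \<le> i")
      case True
      \<comment> \<open>The polynomial is zero, and there are no lattice points since
        \<open>Suc i \<le> k\<close> fails.\<close>
      then show ?thesis by (auto simp: nonneg_coeffs_def lattice_pts_def)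
    next
      case False
      let ?g = "\<Sum>m = Suc i..k. var m * beta_const i j k"
      have nonneg: "nonneg_coeffs (var m * beta_const i j k)" for m
        using Suc.IH[of k] nonneg_coeffs_var_mult by blast
      have keys: "Poly_Mapping.keys ?g =
          (\<Union>m\<in>{Suc i..k}. (+) (Poly_Mapping.single m 1) ` lattice_pts i j k)"
        unfolding nonneg_coeffs_sum(2)[OF finite_atLeastAtMost nonneg] keys_var_mult
        using Suc.IH[of k] by metis
      have eq: "beta_const (Suc i) j k = beta_const i j (k - 1) + ?g"
        using False by (simp only: beta_const.simps sum_distrib_right if_False)
      have "nonneg_coeffs ?g"
        by (intro nonneg_coeffs_sum(1) nonneg finite_atLeastAtMost)
      with Suc.IH[of "k - 1"] have "nonneg_coeffs (beta_const i j (k - 1))" "nonneg_coeffs ?g"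
        by blast+
      from nonneg_coeffs_add[OF this] show ?thesis
        using Suc.IH[of "k - 1"] lattice_pts_Suc[of i k j] False
        unfolding eq keys by simp
    qed
  qed
  then show "Poly_Mapping.keys (beta_const i j k) = lattice_pts i j k"
    and "nonneg_coeffs (beta_const i j k)"
    by auto
qed

section \<open>Integral points of \<open>Q\<close> as exponent vectors\<close>

lemma lookup_map_real [simp]:
  "Poly_Mapping.lookup (Poly_Mapping.map real a) m = real (Poly_Mapping.lookup a m)"
  by (simp add: map.rep_eq when_def)

lemma keys_map_real [simp]: "Poly_Mapping.keys (Poly_Mapping.map real a) = Poly_Mapping.keys a"
  by (auto simp: in_keys_iff)

text \<open>Since \<open>k \<le> n\<close> and the coordinates beyond \<open>k\<close> vanish, sums
  up to \<open>n\<close> and up to \<open>k\<close> agree; the rest is a transfer from real to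
  natural arithmetic.\<close>

lemma map_real_in_Q_iff:
  assumes "max i j \<le> k" "k \<le> min (i + j) n"
  shows "Poly_Mapping.map real a \<in> Q n i j k \<longleftrightarrow> a \<in> lattice_pts i j k"
proof -
  let ?s = "\<lambda>l. \<Sum>m = 1..l. Poly_Mapping.lookup a m"
  have keys: "Poly_Mapping.keys a \<subseteq> {1..k} \<longleftrightarrow> Poly_Mapping.keys a \<subseteq> {1..n} \<and>
      (\<forall>m \<in> {1..n}. m > k \<longrightarrow> Poly_Mapping.lookup a m = 0)"
  proof -
    have "{1..k} = {1..n} - {m \<in> {1..n}. m > k}"
      using assms(2) by auto
    then have "Poly_Mapping.keys a \<subseteq> {1..k} \<longleftrightarrow>
        Poly_Mapping.keys a \<subseteq> {1..n} \<and> (\<forall>m \<in> {1..n}. m > k \<longrightarrow> m \<notin> Poly_Mapping.keys a)"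
      by blast
    then show ?thesis
      unfolding not_in_keys_iff_lookup_eq_zero .
  qed
  have sum_k: "?s n = ?s k" if "Poly_Mapping.keys a \<subseteq> {1..k}"
    using that assms(2) by (intro sum.mono_neutral_right) (auto simp: in_keys_iff subset_iff)
  have sum: "real (?s n) = real i + real j - real k \<longleftrightarrow> k + ?s n = i + j"
    by linarith
  have le: "(\<forall>l \<in> {1..i}. real (?s l) \<le> real l) \<longleftrightarrow> (\<forall>l \<le> i. ?s l \<le> l)"
  proof -
    \<comment> \<open>The extra index 0 contributes only \<open>0 \<le> 0\<close>.\<close>
    have "{..i} = insert 0 {1..i}" by auto
    then have "(\<forall>l \<in> {..i}. ?s l \<le> l) \<longleftrightarrow> (\<forall>l \<in> {1..i}. ?s l \<le> l)"
      by simp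
    then show ?thesis
      unfolding of_nat_le_iff Ball_def atMost_iff by simp
  qed
  have Q: "Poly_Mapping.map real a \<in> Q n i j k \<longleftrightarrow> Poly_Mapping.keys a \<subseteq> {1..n} \<and>
      real (?s n) = real i + real j - real k \<and> (\<forall>l \<in> {1..i}. real (?s l) \<le> real l) \<and>
      (\<forall>m \<in> {1..n}. m > k \<longrightarrow> Poly_Mapping.lookup a m = 0)"
    unfolding Q_def Rn_def by simp
  have pts: "a \<in> lattice_pts i j k \<longleftrightarrow> Poly_Mapping.keys a \<subseteq> {1..k} \<and>
      k + ?s k = i + j \<and> (\<forall>l \<le> i. ?s l \<le> l)"
    unfolding lattice_pts_def using assms(1) by simp
  show ?thesis
  proof (cases "Poly_Mapping.keys a \<subseteq> {1..k}")
    case True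
    then have K: "Poly_Mapping.keys a \<subseteq> {1..n}"
      and Z: "\<forall>m \<in> {1..n}. m > k \<longrightarrow> Poly_Mapping.lookup a m = 0"
      using keys by blast+
    show ?thesis
      unfolding Q pts sum le eqTrueI[OF K] eqTrueI[OF Z] eqTrueI[OF True]
      unfolding sum_k[OF True] by (simp only: simp_thms)
  next
    case False
    then show ?thesis
      unfolding Q pts using keys by blast
  qed
qed

lemma Q_Int_Zn_eq:
  assumes "max i j \<le> k" "k \<le> min (i + j) n"
  shows "Q n i j k \<inter> Zn n = Poly_Mapping.map real ` lattice_pts i j k"
proof (intro equalityI subsetI)
  fix x assume x: "x \<in> Q n i j k \<inter> Zn n"
  \<comment> \<open>Coordinates of \<open>x\<close> are nonnegative integers, so taking
    \<open>nat\<close> of the floor loses nothing.\<close>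
  define a where "a = Poly_Mapping.map (\<lambda>y. nat \<lfloor>y\<rfloor>) x"
  have nonneg: "0 \<le> Poly_Mapping.lookup x m" for m
  proof (cases "m \<in> {1..n}")
    case True
    then show ?thesis using x by (simp add: Q_def)
  next
    case False
    then have "Poly_Mapping.lookup x m = 0"
      using x unfolding Q_def Rn_def in_keys_iff subset_iff by blast
    then show ?thesis by simp
  qed
  have "Poly_Mapping.lookup x m \<in> \<int>" for m
    using x by (auto simp: Zn_def)
  then have x_eq: "Poly_Mapping.lookup x m = real (nat \<lfloor>Poly_Mapping.lookup x m\<rfloor>)" for m
    using nonneg[of m] by (metis Ints_cases floor_of_int of_int_0_le_iff of_nat_nat of_int_of_nat_eq)
  have "Poly_Mapping.lookup a m = nat \<lfloor>Poly_Mapping.lookup x m\<rfloor>" for m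
    by (simp add: a_def map.rep_eq when_def)
  then have "x = Poly_Mapping.map real a"
    by (intro poly_mapping_eqI) (simp only: lookup_map_real, rule x_eq)
  then show "x \<in> Poly_Mapping.map real ` lattice_pts i j k"
    using x map_real_in_Q_iff[OF assms] by blast
next
  fix x assume "x \<in> Poly_Mapping.map real ` lattice_pts i j k"
  then obtain a where "a \<in> lattice_pts i j k" "x = Poly_Mapping.map real a" by blast
  with map_real_in_Q_iff[OF assms, of a] show "x \<in> Q n i j k \<inter> Zn n"
    by (simp add: Zn_def Q_def)
qed

section \<open>Convexity of \<open>Q\<close> and saturation\<close>

lemma lookup_scaleR [simp]:
  fixes x :: "'a \<Rightarrow>\<^sub>0 'b::real_vector"
  shows "Poly_Mapping.lookup (r *\<^sub>R x) m = r *\<^sub>R Poly_Mapping.lookup x m"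
proof -
  have "finite {m. r *\<^sub>R Poly_Mapping.lookup x m \<noteq> 0}"
    by (rule finite_subset[OF _ finite_keys[of x]]) (auto simp: in_keys_iff)
  then show ?thesis
    by (simp add: scaleR_poly_mapping_def)
qed

text \<open>All defining conditions are linear equations or weak linear inequalities, hence stable
  under convex combinations.\<close>

lemma convex_Q: "convex (Q n i j k)"
proof (rule convexI)
  fix x y :: "nat \<Rightarrow>\<^sub>0 real" and u v :: real
  assume x: "x \<in> Q n i j k" and y: "y \<in> Q n i j k" and uv: "0 \<le> u" "0 \<le> v" "u + v = 1"
  let ?z = "u *\<^sub>R x + v *\<^sub>R y"
  let ?s = "\<lambda>x l. \<Sum>m = 1..l. Poly_Mapping.lookup x m"
  have z: "Poly_Mapping.lookup ?z m = u * Poly_Mapping.lookup x m + v * Poly_Mapping.lookup y m" for m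
    by (simp add: lookup_add)
  have s: "?s ?z l = u * ?s x l + v * ?s y l" for l
    unfolding z by (simp add: sum.distrib sum_distrib_left)
  have "Poly_Mapping.keys ?z \<subseteq> {1..n}"
  proof -
    have "Poly_Mapping.keys x \<subseteq> {1..n}" "Poly_Mapping.keys y \<subseteq> {1..n}"
      using x y by (simp_all add: Q_def Rn_def)
    moreover have "Poly_Mapping.keys ?z \<subseteq> Poly_Mapping.keys x \<union> Poly_Mapping.keys y"
      by (auto simp: in_keys_iff z)
    ultimately show ?thesis by blast
  qed
  moreover have "?s ?z n = real i + real j - real k"
  proof -
    have "?s ?z n = (u + v) * (real i + real j - real k)"
      using x y unfolding s Q_def distrib_right by simp
    then show ?thesis
      by (simp add: uv)
  qed
  moreover have "?s ?z l \<le> real l" if "l \<in> {1..i}" for l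
    unfolding s using x y that by (intro convex_bound_le uv) (simp_all add: Q_def)
  ultimately show "?z \<in> Q n i j k"
    using x y uv(1,2) unfolding Q_def Rn_def mem_Collect_eq z by simp
qed

theorem theorem3p1:
  fixes n i j k :: nat
  assumes "n \<ge> 1"
    and "max i j \<le> k" and "k \<le> min (i + j) n"
  shows "Supp (in_beta n (structure_constant n i j k)) = Q n i j k \<inter> Zn n
         \<and> SNP n (in_beta n (structure_constant n i j k))"
proof -
  let ?P = "in_beta n (structure_constant n i j k)"
  have Supp: "Supp ?P = Q n i j k \<inter> Zn n"
    using assms(3)
    by (simp add: Supp_def in_beta_structure_constant keys_beta_const Q_Int_Zn_eq[OF assms(2,3)])
  \<comment> \<open>By convexity the hull stays in \<open>Q\<close>, whose lattice points are
    already the support.\<close>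
  have "convex hull (Supp ?P) \<subseteq> Q n i j k"
    unfolding Supp by (intro hull_minimal convex_Q) auto
  then have "SNP n ?P"
    unfolding SNP_def Supp by blast
  with Supp show ?thesis by blast
qed

end
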